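(* Let $1\le n\le p$ be integers and let $X\in\mathbb{R}^{n\times p}$ be a matrix of full rank $n$. Let $\delta$ be the distortion of $\ker(X)$ and let $\rho_n>0$ be the smallest singular value of $X$. Let $0<\kappa_0<1/2$. Then $X$ satisfies $\mathrm{UDP}(S_0,\kappa_0,\Delta)$ with $$S_0=\Big(\frac{\kappa_0}{\delta}\Big)^2p\qquad\text{and}\qquad \Delta=\frac{2\delta}{\rho_n}.$$
   Context: For $x\in\mathbb{R}^m$, $\|x\|_{\ell_1}=\sum_i|x_i|$ and $\|x\|_{\ell_2}=(\sum_i x_i^2)^{1/2}$. The singular values of the rank-$n$ matrix $X\in\mathbb{R}^{n\times p}$ ($n\le p$) are $\rho_1\ge\dots\ge\rho_n>0$. For $\gamma\in\mathbb{R}^p$ and $\mathcal S\subseteq\{1,\dots,p\}$, $\gamma_{\mathcal S}\in\mathbb{R}^p$ is the vector with $(\gamma_{\mathcal S})_i=\gamma_i$ if $i\in\mathcal S$ and $0$ otherwise. A subspace $\Gamma\subset\mathbb{R}^p$ has distortion $\delta$, with $1\le\delta\le\sqrt p$, if $\|x\|_{\ell_1}\le\sqrt p\,\|x\|_{\ell_2}\le\delta\,\|x\|_{\ell_1}$ for all $x\in\Gamma$. "The distortion" of $\Gamma$ is the smallest such $\delta$, i.e. $\delta=\sup_{x\in\Gamma\setminus\{0\}}\sqrt p\,\|x\|_{\ell_2}/\|x\|_{\ell_1}$ (and $\delta=1$ if $\Gamma=\{0\}$). Universal Distortion Property: $X$ satisfies $\mathrm{UDP}(S_0,\kappa_0,\Delta)$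 if for all $\gamma\in\mathbb{R}^p$, all integers $s$ with $1\le s\le S_0$, and all $\mathcal S\subseteq\{1,\dots,p\}$ with $|\mathcal S|=s$, $$\|\gamma_{\mathcal S}\|_{\ell_1}\le\Delta\sqrt s\,\|X\gamma\|_{\ell_2}+\kappa_0\|\gamma\|_{\ell_1}.$$ (Here $S_0$ need not be an integer; if $S_0<1$ the property is vacuous.) *)

theory Defs
  imports "HOL-Analysis.Analysis"
begin

text \<open>The \<open>\<ell>\<^sub>2\<close> norm on \<^typ>\<open>real ^ 'm\<close> is the library's \<^const>\<open>norm\<close>.\<close>

definition l1_norm :: "real ^ 'm \<Rightarrow> real" where
  "l1_norm x = (\<Sum>i\<in>UNIV. \<bar>x $ i\<bar>)"

definition restrict_vec :: "real ^ 'p \<Rightarrow> 'p set \<Rightarrow> real ^ 'p" where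
  "restrict_vec x S = (\<chi> i. if i \<in> S then x $ i else 0)"

definition mat_kernel :: "real ^ 'p ^ 'n \<Rightarrow> (real ^ 'p) set" where
  "mat_kernel X = {x. X *v x = 0}"

text \<open>Singular values are the \<open>s \<ge> 0\<close> admitting a pair of unit singular vectors (left \<open>u\<close>,
  right \<open>v\<close>).  For \<open>n \<le> p\<close> these are the square roots of the eigenvalues of the
  \<open>n \<times> n\<close> matrix \<open>X X\<^sup>T\<close>; the additional eigenvalues \<open>0\<close> of \<open>X\<^sup>T X\<close> that are only
  due to \<open>n < p\<close> are excluded, since the same \<open>s\<close> has to serve both \<open>u\<close> and \<open>v\<close>.
  Multiplicities are dropped, which does not affect the smallest one.\<close>

definition singular_values :: "real ^ 'p ^ 'n \<Rightarrow> real set" where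
  "singular_values X =
    {s. 0 \<le> s \<and> (\<exists>u v. norm u = 1 \<and> norm v = 1 \<and>
           X *v v = s *\<^sub>R u \<and> transpose X *v u = s *\<^sub>R v)}"

definition smallest_singular_value :: "real ^ 'p ^ 'n \<Rightarrow> real" where
  "smallest_singular_value X = Min (singular_values X)"

definition has_distortion :: "(real ^ 'p) set \<Rightarrow> real \<Rightarrow> bool" where
  "has_distortion \<Gamma> \<delta> \<longleftrightarrow>
    1 \<le> \<delta> \<and> \<delta> \<le> sqrt (real CARD('p)) \<and>
    (\<forall>x\<in>\<Gamma>. l1_norm x \<le> sqrt (real CARD('p)) * norm x \<and>
            sqrt (real CARD('p)) * norm x \<le> \<delta> * l1_norm x)"

text \<open>For \<open>\<Gamma> = {0}\<close> the bound \<open>1 \<le> \<delta>\<close> in \<^const>\<open>has_distortion\<close> makes the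
  distortion \<open>1\<close>.\<close>

definition distortion :: "(real ^ 'p) set \<Rightarrow> real" where
  "distortion \<Gamma> = (LEAST \<delta>. has_distortion \<Gamma> \<delta>)"

text \<open>The sparsity bound \<open>S\<^sub>0\<close> is a real number.\<close>

definition UDP :: "real ^ 'p ^ 'n \<Rightarrow> real \<Rightarrow> real \<Rightarrow> real \<Rightarrow> bool" where
  "UDP X S\<^sub>0 \<kappa>\<^sub>0 \<Delta> \<longleftrightarrow>
    (\<forall>\<gamma> (s::nat) S. 1 \<le> s \<and> real s \<le> S\<^sub>0 \<and> card S = s \<longrightarrow>
       l1_norm (restrict_vec \<gamma> S) \<le> \<Delta> * sqrt (real s) * norm (X *v \<gamma>) + \<kappa>\<^sub>0 * l1_norm \<gamma>)"

end

theory Submission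
  imports Defs
begin

text \<open>
  Split \<open>\<gamma> = x + y\<close> with \<open>x\<close> in the kernel of \<open>X\<close> and \<open>y\<close> in the row space
  (\<open>kernel_plus_row_space\<close>).  On a set of \<open>s\<close> coordinates the \<open>\<ell>\<^sub>1\<close> norm is at most
  \<open>sqrt s\<close> times the \<open>\<ell>\<^sub>2\<close> norm, so it suffices to control \<open>norm x\<close> and \<open>norm y\<close>.
  The kernel part is spread out: its distortion gives
  \<open>norm x \<le> \<delta> / sqrt p * l1_norm x \<le> \<delta> / sqrt p * l1_norm \<gamma> + \<delta> * norm y\<close>.
  Multiplied by \<open>sqrt s \<le> \<kappa>\<^sub>0 * sqrt p / \<delta>\<close>, the first summand becomes
  \<open>\<kappa>\<^sub>0 * l1_norm \<gamma>\<close>.  What remains is \<open>sqrt s * (\<delta> + 1) * norm y\<close>, where \<open>\<delta> + 1 \<le> 2 * \<delta>\<close>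
  and \<open>norm y \<le> norm (X *v \<gamma>) / \<rho>\<^sub>n\<close>, since \<open>X\<close> stretches every row space vector by at least
  its smallest singular value.

  Two facts connect this estimate with the definitions.  The least admissible distortion
  constant exists, because the admissible constants form a nonempty closed set that is bounded
  below (\<open>has_distortion_distortion\<close>).  The smallest singular value is the minimum of
  \<open>norm (transpose X *v u)\<close> over unit vectors \<open>u\<close>: a minimizer is an eigenvector of
  \<open>X ** transpose X\<close> and hence belongs to a singular pair
  (\<open>smallest_singular_value_variational\<close>).
\<close>

section \<open>The \<open>\<ell>\<^sub>1\<close> norm\<close>

lemma l1_norm_add_le: "l1_norm (x + y) \<le> l1_norm x + l1_norm y"
  unfolding l1_norm_def by (simp add: sum.distrib[symmetric] sum_mono)

lemma l1_norm_diff_le: "l1_norm (x - y) \<le> l1_norm x + l1_norm y"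
  unfolding l1_norm_def by (simp add: sum.distrib[symmetric] sum_mono)

lemma l1_norm_nonneg: "0 \<le> l1_norm x"
  unfolding l1_norm_def by (simp add: sum_nonneg)

lemma norm_le_l1_norm: "norm x \<le> l1_norm x"
  unfolding l1_norm_def by (rule norm_le_l1_cart)

lemma restrict_vec_add: "restrict_vec (x + y) S = restrict_vec x S + restrict_vec y S"
  by (simp add: restrict_vec_def vec_eq_iff)

lemma restrict_vec_UNIV: "restrict_vec x UNIV = x"
  by (simp add: restrict_vec_def vec_eq_iff)

text \<open>Cauchy--Schwarz against the indicator vector of \<open>S\<close>.\<close>

lemma l1_norm_restrict_vec_le:
  fixes x :: "real ^ 'p"
  shows "l1_norm (restrict_vec x S) \<le> sqrt (real (card S)) * norm x"
proof -
  have "l1_norm (restrict_vec x S) = (\<Sum>i\<in>UNIV. if i \<in> S then \<bar>x $ i\<bar> else 0)"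
    unfolding l1_norm_def restrict_vec_def by (intro sum.cong) auto
  also have "\<dots> = (\<Sum>i\<in>S. \<bar>1::real\<bar> * \<bar>x $ i\<bar>)"
    by (simp add: sum.If_cases)
  also have "\<dots> \<le> L2_set (\<lambda>_. 1) S * L2_set (\<lambda>i. x $ i) S"
    by (rule L2_set_mult_ineq)
  also have "\<dots> = sqrt (real (card S)) * L2_set (\<lambda>i. x $ i) S"
    by (simp add: L2_set_def)
  also have "L2_set (\<lambda>i. x $ i) S \<le> L2_set (\<lambda>i. x $ i) UNIV"
    unfolding L2_set_def by (intro real_sqrt_le_mono sum_mono2) auto
  also have "L2_set (\<lambda>i. x $ i) UNIV = norm x"
    by (simp add: norm_vec_def L2_set_def)
  finally show ?thesis
    by (simp add: mult_left_mono)
qed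

lemma l1_norm_le_sqrt_norm:
  fixes x :: "real ^ 'p"
  shows "l1_norm x \<le> sqrt (real CARD('p)) * norm x"
  using l1_norm_restrict_vec_le[of x UNIV] by (simp add: restrict_vec_UNIV)

section \<open>The distortion of a set\<close>

text \<open>The constant \<open>sqrt p\<close> is admissible for every set, and admissibility consists of
  non-strict inequalities in \<open>\<delta>\<close>, so the infimum of the admissible constants is itself
  admissible.\<close>

lemma has_distortion_distortion:
  fixes \<Gamma> :: "(real ^ 'p) set"
  shows "has_distortion \<Gamma> (distortion \<Gamma>)"
proof -
  define D where "D = {\<delta>. has_distortion \<Gamma> \<delta>}"
  have "sqrt (real CARD('p)) \<in> D"
    by (auto simp: D_def has_distortion_def l1_norm_le_sqrt_norm norm_le_l1_norm
        intro!: mult_left_mono)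
  then have ne: "D \<noteq> {}" by auto
  have bdd: "bdd_below D"
    by (auto simp: D_def has_distortion_def intro!: bdd_belowI[of _ 1])
  have "D = {1..sqrt (real CARD('p))} \<inter>
      (\<Inter>x\<in>\<Gamma>. {\<delta>. sqrt (real CARD('p)) * norm x \<le> \<delta> * l1_norm x})"
    by (auto simp: D_def has_distortion_def l1_norm_le_sqrt_norm)
  moreover have "closed {\<delta>. sqrt (real CARD('p)) * norm x \<le> \<delta> * l1_norm x}" for x :: "real ^ 'p"
    by (intro closed_Collect_le continuous_intros)
  ultimately have "closed D"
    by (auto intro!: closed_Int closed_INT)
  with ne bdd have "Inf D \<in> D"
    by (intro closed_contains_Inf)
  moreover from this have "has_distortion \<Gamma> (Inf D)"
    by (simp add: D_def)
  moreover have "Inf D \<le> \<delta>" if "has_distortion \<Gamma> \<delta>" for \<delta>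
    using that bdd by (auto simp: D_def intro: cInf_lower)
  ultimately have "distortion \<Gamma> = Inf D"
    unfolding distortion_def by (intro Least_equality) (simp_all add: D_def)
  with \<open>Inf D \<in> D\<close> show ?thesis
    by (simp add: D_def)
qed

section \<open>The smallest singular value\<close>

text \<open>First-order optimality of a Rayleigh quotient, in a form that avoids derivatives.
  The quadratic form \<open>z \<mapsto> (norm (A *v z))\<^sup>2 - \<mu>\<^sup>2 * (norm z)\<^sup>2\<close> is nonnegative and vanishes
  at \<open>u\<close>.  Its gradient at \<open>u\<close> is twice the difference of the two sides of the claim,
  and must be zero, since a small step against it would make the form negative.\<close>

lemma minimizer_eigenvector:
  fixes A :: "real ^ 'n ^ 'p"
  assumes lower: "\<And>w. \<mu> * norm w \<le> norm (A *v w)"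
    and attained: "norm (A *v u) = \<mu> * norm u"
    and "0 \<le> \<mu>"
  shows "transpose A *v (A *v u) = \<mu>\<^sup>2 *\<^sub>R u"
proof -
  define w where "w = transpose A *v (A *v u) - \<mu>\<^sup>2 *\<^sub>R u"
  define b where "b = w \<bullet> w"
  define c where "c = (norm (A *v w))\<^sup>2 - \<mu>\<^sup>2 * (norm w)\<^sup>2"
  have sq: "\<mu>\<^sup>2 * (norm z)\<^sup>2 \<le> (norm (A *v z))\<^sup>2" for z
    using power_mono[OF lower[of z], of 2] \<open>0 \<le> \<mu>\<close> by (simp add: power_mult_distrib)
  have c: "0 \<le> c"
    using sq[of w] by (simp add: c_def)
  have b_eq: "(A *v u) \<bullet> (A *v w) - \<mu>\<^sup>2 * (u \<bullet> w) = b"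
    by (simp add: b_def w_def inner_diff_left dot_lmul_matrix[symmetric] transpose_matrix_vector)
  have quad: "0 \<le> 2 * t * b + t\<^sup>2 * c" for t :: real
  proof -
    have "(norm (A *v (u + t *\<^sub>R w)))\<^sup>2 - \<mu>\<^sup>2 * (norm (u + t *\<^sub>R w))\<^sup>2
        = ((norm (A *v u))\<^sup>2 - \<mu>\<^sup>2 * (norm u)\<^sup>2)
          + 2 * t * ((A *v u) \<bullet> (A *v w) - \<mu>\<^sup>2 * (u \<bullet> w)) + t\<^sup>2 * c"
      by (simp add: c_def matrix_vector_right_distrib matrix_vector_mult_scaleR power2_norm_eq_inner
          inner_add_left inner_add_right inner_commute algebra_simps)
       (simp add: power2_eq_square algebra_simps)
    also have "\<dots> = 2 * t * b + t\<^sup>2 * c"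
      by (simp add: b_eq attained power_mult_distrib)
    finally show ?thesis
      using sq[of "u + t *\<^sub>R w"] by simp
  qed
  \<comment> \<open>Minimizing over \<open>t\<close> would give \<open>- b / c\<close>; the shift avoids the case \<open>c = 0\<close>.\<close>
  define t where "t = - b / (c + 1)"
  have b: "b = - (t * (c + 1))"
    using c by (simp add: t_def)
  have "0 \<le> 2 * t * b + t\<^sup>2 * c"
    by (rule quad)
  also have "\<dots> = - (t\<^sup>2 * (c + 2))"
    by (simp add: b power2_eq_square algebra_simps)
  finally have "t = 0"
    using c by (simp add: mult_le_0_iff)
  then have "b = 0"
    by (simp add: b)
  then show ?thesis
    by (simp add: b_def w_def)
qed

text \<open>Left singular vectors are eigenvectors of the symmetric matrix \<open>X ** transpose X\<close>,
  so those for different singular values are orthogonal, and there are at most \<open>CARD('n)\<close>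
  of them.\<close>

lemma finite_singular_values:
  fixes X :: "real ^ 'p ^ 'n"
  shows "finite (singular_values X)"
proof -
  have "\<forall>s\<in>singular_values X. \<exists>u. norm u = 1 \<and> X *v (transpose X *v u) = s\<^sup>2 *\<^sub>R u"
    by (auto simp: singular_values_def matrix_vector_mult_scaleR power2_eq_square)
  then obtain U where norm_U: "\<And>s. s \<in> singular_values X \<Longrightarrow> norm (U s) = 1"
    and eig: "\<And>s. s \<in> singular_values X \<Longrightarrow> X *v (transpose X *v U s) = s\<^sup>2 *\<^sub>R U s"
    by metis
  have orth: "U s \<bullet> U t = 0"
    if s: "s \<in> singular_values X" and t: "t \<in> singular_values X" and "s \<noteq> t" for s t
  proof -
    have sym: "(X *v (transpose X *v a)) \<bullet> b = (transpose X *v a) \<bullet> (transpose X *v b)" for a b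
      by (metis dot_lmul_matrix inner_commute transpose_matrix_vector)
    have "s\<^sup>2 * (U s \<bullet> U t) = t\<^sup>2 * (U s \<bullet> U t)"
      using sym[of "U s" "U t"] sym[of "U t" "U s"] by (simp add: eig s t inner_commute del: transpose_matrix_vector)
    moreover have "s\<^sup>2 \<noteq> t\<^sup>2"
      using s t \<open>s \<noteq> t\<close> by (auto simp: singular_values_def power2_eq_iff)
    ultimately show ?thesis by simp
  qed
  have inj: "inj_on U (singular_values X)"
  proof (rule inj_onI, rule ccontr)
    fix s t assume "s \<in> singular_values X" "t \<in> singular_values X" "U s = U t" "s \<noteq> t"
    then show False
      using orth[of s t] norm_U[of t] by auto
  qed
  have "independent (U ` singular_values X)"
  proof (rule pairwise_orthogonal_independent)
    show "pairwise orthogonal (U ` singular_values X)"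
      by (auto simp: pairwise_def orthogonal_def intro: orth)
    show "0 \<notin> U ` singular_values X"
      using norm_U by force
  qed
  then show ?thesis
    using inj independent_bound finite_imageD by blast
qed

text \<open>Compactness of the unit sphere provides a minimizer \<open>u\<close> of \<open>norm (transpose X *v u)\<close>;
  its eigenvector property makes \<open>u\<close> and the normalized vector \<open>transpose X *v u\<close> a singular
  pair.  Any other singular pair gives a value of the same function on the sphere, so it is
  not smaller.  Full row rank makes \<open>transpose X\<close> injective, hence the minimum positive.\<close>

lemma smallest_singular_value_variational:
  fixes X :: "real ^ 'p ^ 'n"
  assumes "rank X = CARD('n)"
  shows "0 < smallest_singular_value X"
    and "smallest_singular_value X * norm w \<le> norm (transpose X *v w)"
proof -
  let ?A = "transpose X"
  have inj: "inj ((*v) ?A)"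
    using assms full_rank_injective[of ?A] by (simp add: rank_transpose)
  have "continuous_on (sphere 0 1) (\<lambda>u. norm (?A *v u))"
    by (intro continuous_intros)
  moreover have "sphere 0 1 \<noteq> ({} :: (real ^ 'n) set)"
    by simp
  ultimately obtain u where u: "norm u = 1"
    and min: "\<And>w. norm w = 1 \<Longrightarrow> norm (?A *v u) \<le> norm (?A *v w)"
    using continuous_attains_inf[of "sphere 0 1" "\<lambda>u. norm (?A *v u)"] by auto
  define \<mu> where "\<mu> = norm (?A *v u)"
  have "?A *v u \<noteq> 0"
    using injD[OF inj, of u 0] u by auto
  then have pos: "0 < \<mu>"
    by (simp add: \<mu>_def)
  have lower: "\<mu> * norm w \<le> norm (?A *v w)" for w
  proof (cases "w = 0")
    case False
    then have "\<mu> \<le> norm (?A *v (inverse (norm w) *\<^sub>R w))"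
      unfolding \<mu>_def by (intro min) simp
    also have "\<dots> = norm (?A *v w) / norm w"
      by (simp add: matrix_vector_mult_scaleR divide_inverse mult.commute)
    finally show ?thesis
      using False by (simp add: field_simps)
  qed simp
  have eig: "X *v (?A *v u) = \<mu>\<^sup>2 *\<^sub>R u"
    using minimizer_eigenvector[of \<mu> ?A u] lower pos u by (simp add: \<mu>_def)
  have "\<mu> \<in> singular_values X"
    unfolding singular_values_def
  proof (intro CollectI conjI exI)
    show "norm (inverse \<mu> *\<^sub>R (?A *v u)) = 1"
      using pos by (simp add: \<mu>_def)
    show "X *v (inverse \<mu> *\<^sub>R (?A *v u)) = \<mu> *\<^sub>R u"
      using pos by (simp add: matrix_vector_mult_scaleR eig power2_eq_square del: transpose_matrix_vector)
  qed (use pos u in auto)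
  moreover have "\<mu> \<le> s" if "s \<in> singular_values X" for s
  proof -
    from that obtain a b where "0 \<le> s" "norm a = 1" "norm b = 1" "?A *v a = s *\<^sub>R b"
      by (auto simp: singular_values_def)
    then show ?thesis
      using lower[of a] by simp
  qed
  ultimately have "smallest_singular_value X = \<mu>"
    unfolding smallest_singular_value_def
    by (intro Min_eqI finite_singular_values)
  with pos lower show "0 < smallest_singular_value X"
    and "smallest_singular_value X * norm w \<le> norm (?A *v w)" by auto
qed

text \<open>The lower bound for \<open>transpose X\<close> transfers to \<open>X\<close> on the row space: for
  \<open>y = transpose X *v u\<close> one has \<open>(norm y)\<^sup>2 = u \<bullet> (X *v y) \<le> norm u * norm (X *v y)\<close>, and
  \<open>norm u\<close> is at most \<open>norm y\<close> divided by the smallest singular value.\<close>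

lemma smallest_singular_value_row_space:
  fixes X :: "real ^ 'p ^ 'n"
  assumes "rank X = CARD('n)"
  shows "smallest_singular_value X * norm (transpose X *v u) \<le> norm (X *v (transpose X *v u))"
proof (cases "transpose X *v u = 0")
  case False
  let ?\<rho> = "smallest_singular_value X" and ?y = "transpose X *v u"
  have "?\<rho> * norm ?y * norm ?y = ?\<rho> * (?y \<bullet> ?y)"
    by (simp add: dot_square_norm power2_eq_square)
  also have "?y \<bullet> ?y = u \<bullet> (X *v ?y)"
    by (metis dot_lmul_matrix transpose_matrix_vector)
  also have "\<dots> \<le> norm u * norm (X *v ?y)"
    by (rule norm_cauchy_schwarz)
  also have "?\<rho> * (norm u * norm (X *v ?y)) = (?\<rho> * norm u) * norm (X *v ?y)"
    by simp
  also have "\<dots> \<le> norm ?y * norm (X *v ?y)"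
    by (intro mult_right_mono smallest_singular_value_variational assms) simp
  finally have "(?\<rho> * norm ?y) * norm ?y \<le> norm (X *v ?y) * norm ?y"
    using smallest_singular_value_variational(1)[OF assms] by (simp add: mult.commute)
  with False show ?thesis
    by simp
qed simp

text \<open>The Gram matrix \<open>X ** transpose X\<close> is injective, hence surjective, so some row space
  vector has the same image under \<open>X\<close> as \<open>\<gamma>\<close>.\<close>

lemma kernel_plus_row_space:
  fixes X :: "real ^ 'p ^ 'n"
  assumes "rank X = CARD('n)"
  obtains x u where "x \<in> mat_kernel X" and "\<gamma> = x + transpose X *v u"
proof -
  have "w = 0" if "X *v (transpose X *v w) = 0" for w
  proof -
    note pos = smallest_singular_value_variational(1)[OF assms]
    have "norm (transpose X *v w) \<le> 0"
      using smallest_singular_value_row_space[OF assms, of w] that pos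
      by (simp add: mult_le_0_iff del: transpose_matrix_vector)
    then show ?thesis
      using smallest_singular_value_variational(2)[OF assms, of w] pos
      by (simp add: mult_le_0_iff del: transpose_matrix_vector)
  qed
  then have "inj ((*v) (X ** transpose X))"
    by (simp add: linear_injective_0 matrix_vector_mul_assoc[symmetric])
  then have "surj ((*v) (X ** transpose X))"
    by (intro linear_injective_imp_surjective) auto
  then obtain u where "X *v \<gamma> = X *v (transpose X *v u)"
    by (metis surjD matrix_vector_mul_assoc)
  then have "\<gamma> - transpose X *v u \<in> mat_kernel X"
    by (simp add: mat_kernel_def matrix_vector_mult_diff_distrib)
  then show ?thesis
    by (rule that) simp
qed

section \<open>The universal distortion property\<close>

theorem theorem1p2:
  fixes X :: "real ^ 'p ^ 'n" and \<delta> \<rho>\<^sub>n \<kappa>\<^sub>0 :: real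
  assumes "CARD('n) \<le> CARD('p)"
    and "rank X = CARD('n)"
    and "\<delta> = distortion (mat_kernel X)"
    and "\<rho>\<^sub>n = smallest_singular_value X"
    and "0 < \<kappa>\<^sub>0" and "\<kappa>\<^sub>0 < 1 / 2"
  shows "UDP X ((\<kappa>\<^sub>0 / \<delta>)\<^sup>2 * real CARD('p)) \<kappa>\<^sub>0 (2 * \<delta> / \<rho>\<^sub>n)"
  unfolding UDP_def
proof (intro allI impI, elim conjE)
  fix \<gamma> :: "real ^ 'p" and s :: nat and S :: "'p set"
  assume s: "real s \<le> (\<kappa>\<^sub>0 / \<delta>)\<^sup>2 * real CARD('p)" and S: "card S = s"
  have dist: "has_distortion (mat_kernel X) \<delta>"
    using assms(3) has_distortion_distortion by simp
  then have \<delta>: "1 \<le> \<delta>"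
    by (simp add: has_distortion_def)
  have \<rho>: "0 < \<rho>\<^sub>n"
    using smallest_singular_value_variational(1) assms(2,4) by simp
  define P where "P = sqrt (real CARD('p))"
  have P: "0 < P"
    by (simp add: P_def)
  obtain x u where x: "x \<in> mat_kernel X" and split: "\<gamma> = x + transpose X *v u"
    using kernel_plus_row_space[OF assms(2)] .
  define y where "y = transpose X *v u"
  have \<gamma>: "\<gamma> = x + y"
    by (simp add: split y_def)
  have "X *v \<gamma> = X *v y"
    using x by (simp add: \<gamma> mat_kernel_def matrix_vector_right_distrib)
  then have y: "norm y \<le> norm (X *v \<gamma>) / \<rho>\<^sub>n"
    using smallest_singular_value_row_space[OF assms(2), of u] assms(4) \<rho>
    by (simp add: y_def field_simps)
  have "sqrt (real s) \<le> sqrt ((\<kappa>\<^sub>0 / \<delta>)\<^sup>2 * real CARD('p))"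
    using s by (rule real_sqrt_le_mono)
  also have "\<dots> = \<kappa>\<^sub>0 / \<delta> * P"
    using \<delta> assms(5) by (simp add: real_sqrt_mult P_def)
  finally have sqrt_s: "sqrt (real s) * \<delta> \<le> \<kappa>\<^sub>0 * P"
    using \<delta> by (simp add: field_simps)
  have "P * norm x \<le> \<delta> * l1_norm x"
    using dist x by (simp add: has_distortion_def P_def)
  also have "l1_norm x \<le> l1_norm \<gamma> + l1_norm y"
    using l1_norm_diff_le[of \<gamma> y] by (simp add: \<gamma>)
  also have "l1_norm y \<le> P * norm y"
    unfolding P_def by (rule l1_norm_le_sqrt_norm)
  finally have "P * norm x \<le> \<delta> * (l1_norm \<gamma> + P * norm y)"
    using \<delta> by simp
  then have "sqrt (real s) * (P * norm x) \<le> sqrt (real s) * (\<delta> * (l1_norm \<gamma> + P * norm y))"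
    by (rule mult_left_mono) simp
  also have "\<dots> = (sqrt (real s) * \<delta>) * l1_norm \<gamma> + P * (sqrt (real s) * \<delta> * norm y)"
    by (simp add: algebra_simps)
  also have "\<dots> \<le> (\<kappa>\<^sub>0 * P) * l1_norm \<gamma> + P * (sqrt (real s) * \<delta> * norm y)"
    using sqrt_s by (intro add_right_mono mult_right_mono l1_norm_nonneg)
  finally have "P * (sqrt (real s) * norm x) \<le> P * (\<kappa>\<^sub>0 * l1_norm \<gamma> + sqrt (real s) * \<delta> * norm y)"
    by (simp add: algebra_simps)
  then have x_bound: "sqrt (real s) * norm x \<le> \<kappa>\<^sub>0 * l1_norm \<gamma> + sqrt (real s) * \<delta> * norm y"
    using P by simp
  have "l1_norm (restrict_vec \<gamma> S) \<le> l1_norm (restrict_vec x S) + l1_norm (restrict_vec y S)"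
    by (simp add: \<gamma> restrict_vec_add l1_norm_add_le)
  also have "\<dots> \<le> sqrt (real s) * norm x + sqrt (real s) * norm y"
    using l1_norm_restrict_vec_le[of _ S] by (simp add: S add_mono)
  also have "\<dots> \<le> \<kappa>\<^sub>0 * l1_norm \<gamma> + sqrt (real s) * ((\<delta> + 1) * norm y)"
    using x_bound by (simp add: algebra_simps)
  also have "\<dots> \<le> \<kappa>\<^sub>0 * l1_norm \<gamma> + sqrt (real s) * ((2 * \<delta>) * (norm (X *v \<gamma>) / \<rho>\<^sub>n))"
    using \<delta> y by (intro add_left_mono mult_left_mono mult_mono) auto
  finally show "l1_norm (restrict_vec \<gamma> S)
      \<le> 2 * \<delta> / \<rho>\<^sub>n * sqrt (real s) * norm (X *v \<gamma>) + \<kappa>\<^sub>0 * l1_norm \<gamma>"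
    by (simp add: algebra_simps)
qed

end
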